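(* Let $K_{11}=(k(X_i,X_{i'}))_{i,i'=1}^n$ be the Gram matrix of a kernel $k$ at points $X_1,\dots,X_n$, assumed positive definite, and let $\lambda>0$. Put $$H_{\mathrm{KuLSIF}}=\frac1nK_{11}^2+\lambda K_{11},\qquad H_{\mathrm{R\text{-}KuLSIF}}=\frac1nK_{11}+\lambda I_n.$$ Then $$\kappa(H_{\mathrm{KuLSIF}})=\kappa(K_{11})\,\kappa(H_{\mathrm{R\text{-}KuLSIF}}),$$ and consequently $$\kappa(H_{\mathrm{R\text{-}KuLSIF}})\le\kappa(H_{\mathrm{KuLSIF}});\qquad\text{moreover}\qquad\kappa(H_{\mathrm{R\text{-}KuLSIF}})\le\kappa(K_{11}).$$
   Context: For a symmetric positive definite matrix $A$, $\kappa(A)=\lambda_{\max}(A)/\lambda_{\min}(A)$. $I_n$ is the $n\times n$ identity matrix. With further points $Y_1,\dots,Y_m$, $K_{12}=(k(X_i,Y_j))_{ij}$, $K_{21}=K_{12}^\top$ and $\mathbf 1_m=(1,\dots,1)^\top\in\mathbb{R}^m$, the matrix $H_{\mathrm{KuLSIF}}$ is the Hessian of the KuLSIF objective $\alpha\mapsto\frac12\alpha^\top(\frac1nK_{11}^2+\lambda K_{11})\alpha+\frac{1}{nm\lambda}\mathbf 1_m^\top K_{21}K_{11}\alpha$, and $H_{\mathrm{R\text{-}KuLSIF}}$ is the Hessian of the Reduced-KuLSIF objective $\alpha\mapsto\frac12\alpha^\top(\frac1nK_{11}+\lambda I_n)\alpha+\frac{1}{nm\lambda}\mathbf 1_m^\top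 K_{21}\alpha$, $\alpha\in\mathbb{R}^n$. *)

theory Defs
  imports "Jordan_Normal_Form.Spectral_Radius"
begin

definition pd_kernel :: "('a \<Rightarrow> 'a \<Rightarrow> real) \<Rightarrow> bool" where
  "pd_kernel k \<longleftrightarrow>
     (\<forall>x y. k x y = k y x) \<and>
     (\<forall>(N::nat) (x :: nat \<Rightarrow> 'a) (c :: nat \<Rightarrow> real).
        (\<Sum>i<N. \<Sum>j<N. c i * c j * k (x i) (x j)) \<ge> 0)"

(* The points are X 0, ..., X (n - 1); values of X beyond that play no role. *)
definition gram_mat :: "('a \<Rightarrow> 'a \<Rightarrow> real) \<Rightarrow> nat \<Rightarrow> (nat \<Rightarrow> 'a) \<Rightarrow> real mat" where
  "gram_mat k n X = mat n n (\<lambda>(i, j). k (X i) (X j))"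

definition sym_pos_def :: "real mat \<Rightarrow> bool" where
  "sym_pos_def A \<longleftrightarrow>
     square_mat A \<and> transpose_mat A = A \<and>
     (\<forall>v \<in> carrier_vec (dim_row A). v \<noteq> 0\<^sub>v (dim_row A) \<longrightarrow> v \<bullet> (A *\<^sub>v v) > 0)"

(* Only meaningful when the set of real eigenvalues is nonempty and does not contain 0,
   e.g. for symmetric positive definite matrices of positive dimension. *)
definition cond_num :: "real mat \<Rightarrow> real" where
  "cond_num A = Max (spectrum A) / Min (spectrum A)"

(* Hessian of a \<mapsto> 1/2 a^T (1/n K^2 + lam K) a + (linear term), where K = K_11 is symmetric. *)
definition H_KuLSIF :: "nat \<Rightarrow> real \<Rightarrow> real mat \<Rightarrow> real mat" where
  "H_KuLSIF n lam K = (1 / real n) \<cdot>\<^sub>m (K ^\<^sub>m 2) + lam \<cdot>\<^sub>m K"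

(* Hessian of a \<mapsto> 1/2 a^T (1/n K + lam I) a + (linear term). *)
definition H_RKuLSIF :: "nat \<Rightarrow> real \<Rightarrow> real mat \<Rightarrow> real mat" where
  "H_RKuLSIF n lam K = (1 / real n) \<cdot>\<^sub>m K + lam \<cdot>\<^sub>m 1\<^sub>m n"

end

theory Submission
  imports Defs
begin

text \<open>
  Both Hessians are polynomials in \<open>K\<close>: \<open>p(t) = t\<^sup>2 / n + \<lambda> t\<close> and \<open>q(t) = t / n + \<lambda>\<close>, with
  \<open>p(t) = t q(t)\<close>. Both are increasing on the positive half line, which contains the spectrum of
  \<open>K\<close>, so extreme eigenvalues are mapped to extreme eigenvalues. The spectral mapping property of
  \<open>p\<close> needs no diagonalisation: an eigenvalue \<open>\<mu>\<close> of \<open>p(K)\<close> is positive, so \<open>p - \<mu>\<close> has a positive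
  root \<open>t\<close> and a negative root \<open>s\<close>; as \<open>K - s I\<close> is positive definite, it maps an eigenvector of
  \<open>p(K)\<close> to an eigenvector of \<open>K\<close> for \<open>t\<close>.
\<close>

section \<open>Eigenvalues of real symmetric and positive definite matrices\<close>

lemma mem_spectrum_iff:
  assumes "A \<in> carrier_mat n n"
  shows "t \<in> spectrum A \<longleftrightarrow> (\<exists>v\<in>carrier_vec n. v \<noteq> 0\<^sub>v n \<and> A *\<^sub>v v = t \<cdot>\<^sub>v v)"
  using assms unfolding spectrum_def eigenvalue_def eigenvector_def by auto

lemma smult_mat_mult_vec:
  fixes A :: "'a::comm_ring mat"
  assumes "A \<in> carrier_mat nr nc" "v \<in> carrier_vec nc"
  shows "(c \<cdot>\<^sub>m A) *\<^sub>v v = c \<cdot>\<^sub>v (A *\<^sub>v v)"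
  using assms by (intro eq_vecI) auto

lemma scalar_prod_self_nonneg:
  fixes v :: "real vec"
  shows "v \<bullet> v \<ge> 0"
  by (auto simp: scalar_prod_def intro: sum_nonneg)

lemma scalar_prod_self_pos:
  fixes v :: "real vec"
  assumes "v \<in> carrier_vec n" "v \<noteq> 0\<^sub>v n"
  shows "v \<bullet> v > 0"
proof -
  obtain i where "i < n" "v $ i \<noteq> 0"
    using assms by (metis carrier_vecD eq_vecI index_zero_vec)
  then show ?thesis
    using assms(1) unfolding scalar_prod_def
    by (intro sum_pos2[of _ i]) (auto simp: zero_less_mult_iff linorder_neq_iff)
qed

lemma symmetric_scalar_prod:
  fixes A :: "'a::comm_semiring_0 mat"
  assumes "A \<in> carrier_mat n n" "A\<^sup>T = A" "x \<in> carrier_vec n" "y \<in> carrier_vec n"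
  shows "x \<bullet> (A *\<^sub>v y) = (A *\<^sub>v x) \<bullet> y"
  using transpose_vec_mult_scalar[OF assms(1,4,3)] assms(2) by simp

text \<open>Over the complex numbers an eigenvalue \<open>z\<close> exists; symmetry forces it to be
  real, and then the real or the imaginary part of its eigenvector is a real eigenvector. This is
  what gives \<open>Max\<close> and \<open>Min\<close> of the real spectrum a meaning.\<close>

lemma spectrum_symmetric_nonempty:
  fixes A :: "real mat"
  assumes A: "A \<in> carrier_mat n n" and sym: "A\<^sup>T = A" and "n > 0"
  shows "spectrum A \<noteq> {}"
proof -
  let ?C = "map_mat complex_of_real A"
  have C: "?C \<in> carrier_mat n n" using A by simp
  obtain z v where v: "v \<in> carrier_vec n" "v \<noteq> 0\<^sub>v n" and eig: "?C *\<^sub>v v = z \<cdot>\<^sub>v v"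
    using spectrum_non_empty[OF C \<open>n > 0\<close>] mem_spectrum_iff[OF C] by blast
  define x y where "x = map_vec Re v" and "y = map_vec Im v"
  have x: "x \<in> carrier_vec n" and y: "y \<in> carrier_vec n"
    using v by (auto simp: x_def y_def)
  have entry: "(\<Sum>j<n. of_real (A $$ (i, j)) * v $ j) = z * v $ i" if "i < n" for i
  proof -
    have "(?C *\<^sub>v v) $ i = z * v $ i" using that v by (simp add: eig)
    then show ?thesis
      using that v A by (simp add: scalar_prod_def atLeast0LessThan)
  qed
  \<comment> \<open>As \<open>A\<close> is real, \<open>A (x + i y) = z (x + i y)\<close> splits
    into its real and imaginary parts.\<close>
  have Ax: "A *\<^sub>v x = Re z \<cdot>\<^sub>v x - Im z \<cdot>\<^sub>v y"
    using A v arg_cong[OF entry, of _ Re]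
    by (intro eq_vecI) (auto simp: x_def y_def scalar_prod_def atLeast0LessThan)
  have Ay: "A *\<^sub>v y = Im z \<cdot>\<^sub>v x + Re z \<cdot>\<^sub>v y"
    using A v arg_cong[OF entry, of _ Im]
    by (intro eq_vecI) (auto simp: x_def y_def scalar_prod_def atLeast0LessThan)
  have nz: "x \<noteq> 0\<^sub>v n \<or> y \<noteq> 0\<^sub>v n"
  proof (rule ccontr)
    assume "\<not> ?thesis"
    then have "\<forall>i<n. Re (v $ i) = 0 \<and> Im (v $ i) = 0"
      using v x_def y_def by (metis carrier_vecD index_map_vec(1) index_zero_vec(1))
    then have "v = 0\<^sub>v n" using v by (intro eq_vecI) (auto simp: complex_eq_iff)
    with v show False by simp
  qed
  have "x \<bullet> (A *\<^sub>v y) = Im z * (x \<bullet> x) + Re z * (x \<bullet> y)"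
    unfolding Ay using x y by (simp add: scalar_prod_add_distrib[of _ n])
  moreover have "(A *\<^sub>v x) \<bullet> y = Re z * (x \<bullet> y) - Im z * (y \<bullet> y)"
    unfolding Ax using x y by (simp add: minus_scalar_prod_distrib[of _ n])
  \<comment> \<open>Symmetry equates the two scalar products just computed; the terms with
    \<open>Re z\<close> cancel.\<close>
  ultimately have "Im z * (x \<bullet> x + y \<bullet> y) = 0"
    using symmetric_scalar_prod[OF A sym x y] by (simp add: algebra_simps)
  moreover have "x \<bullet> x + y \<bullet> y > 0"
    using nz x y scalar_prod_self_pos scalar_prod_self_nonneg
    by (metis add_nonneg_pos add_pos_nonneg)
  ultimately have "Im z = 0" by simp
  then have "A *\<^sub>v x = Re z \<cdot>\<^sub>v x" "A *\<^sub>v y = Re z \<cdot>\<^sub>v y"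
    unfolding Ax Ay using x y by (auto intro!: eq_vecI)
  then show ?thesis using nz x y mem_spectrum_iff[OF A] by blast
qed

lemma sym_pos_def_spectrum_pos:
  assumes A: "A \<in> carrier_mat n n" and pd: "sym_pos_def A" and t: "t \<in> spectrum A"
  shows "t > 0"
proof -
  obtain v where v: "v \<in> carrier_vec n" "v \<noteq> 0\<^sub>v n" "A *\<^sub>v v = t \<cdot>\<^sub>v v"
    using t mem_spectrum_iff[OF A] by blast
  have "0 < v \<bullet> (A *\<^sub>v v)" using pd v A unfolding sym_pos_def_def by auto
  also have "\<dots> = t * (v \<bullet> v)" using v by simp
  finally show ?thesis
    using scalar_prod_self_nonneg[of v] by (simp add: zero_less_mult_iff)
qed

section \<open>Spectra of the two Hessians\<close>

lemma H_RKuLSIF_carrier: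
  "K \<in> carrier_mat n n \<Longrightarrow> H_RKuLSIF n lam K \<in> carrier_mat n n"
  by (auto simp: H_RKuLSIF_def)

lemma H_KuLSIF_carrier:
  "K \<in> carrier_mat n n \<Longrightarrow> H_KuLSIF n lam K \<in> carrier_mat n n"
  by (auto simp: H_KuLSIF_def)

lemma H_RKuLSIF_mult_vec:
  assumes "K \<in> carrier_mat n n" "v \<in> carrier_vec n"
  shows "H_RKuLSIF n lam K *\<^sub>v v = (1 / real n) \<cdot>\<^sub>v (K *\<^sub>v v) + lam \<cdot>\<^sub>v v"
  using assms unfolding H_RKuLSIF_def
  by (simp add: add_mult_distrib_mat_vec[of _ n n] smult_mat_mult_vec[of _ n n])

lemma H_KuLSIF_mult_vec:
  assumes "K \<in> carrier_mat n n" "v \<in> carrier_vec n"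
  shows "H_KuLSIF n lam K *\<^sub>v v = (1 / real n) \<cdot>\<^sub>v (K *\<^sub>v (K *\<^sub>v v)) + lam \<cdot>\<^sub>v (K *\<^sub>v v)"
proof -
  have "K ^\<^sub>m 2 = K * K" using assms by (simp add: numeral_2_eq_2)
  then show ?thesis
    using assms unfolding H_KuLSIF_def
    by (simp add: add_mult_distrib_mat_vec[of _ n n] smult_mat_mult_vec[of _ n n]
        assoc_mult_mat_vec[of _ n n _ n])
qed

text \<open>The Hessian is an affine function of \<open>K\<close> with nonzero slope
  \<open>1 / n\<close>, so both matrices have the same eigenvectors;
  \<open>real n * (m - lam)\<close> inverts the map on eigenvalues.\<close>

lemma spectrum_H_RKuLSIF:
  assumes K: "K \<in> carrier_mat n n" and n: "n \<ge> 1"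
  shows "spectrum (H_RKuLSIF n lam K) = (\<lambda>t. t / real n + lam) ` spectrum K"
proof (intro equalityI subsetI)
  fix m assume "m \<in> spectrum (H_RKuLSIF n lam K)"
  then obtain v where v: "v \<in> carrier_vec n" "v \<noteq> 0\<^sub>v n"
    and eig: "(1 / real n) \<cdot>\<^sub>v (K *\<^sub>v v) + lam \<cdot>\<^sub>v v = m \<cdot>\<^sub>v v"
    using mem_spectrum_iff[OF H_RKuLSIF_carrier[OF K]] H_RKuLSIF_mult_vec[OF K] by metis
  have "K *\<^sub>v v = (real n * (m - lam)) \<cdot>\<^sub>v v"
  proof (rule eq_vecI)
    fix i assume "i < dim_vec ((real n * (m - lam)) \<cdot>\<^sub>v v)"
    then have i: "i < n" using v by simp
    have "(1 / real n) * (K *\<^sub>v v) $ i + lam * v $ i = m * v $ i"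
      using arg_cong[OF eig, of "\<lambda>u. u $ i"] i v K by (simp del: index_mult_mat_vec)
    then show "(K *\<^sub>v v) $ i = ((real n * (m - lam)) \<cdot>\<^sub>v v) $ i"
      using i v n by (simp add: field_simps del: index_mult_mat_vec)
  qed (use v K in auto)
  then have "real n * (m - lam) \<in> spectrum K" using v mem_spectrum_iff[OF K] by blast
  moreover have "m = real n * (m - lam) / real n + lam" using n by simp
  ultimately show "m \<in> (\<lambda>t. t / real n + lam) ` spectrum K" by blast
next
  fix m assume "m \<in> (\<lambda>t. t / real n + lam) ` spectrum K"
  then obtain t v where m: "m = t / real n + lam"
    and v: "v \<in> carrier_vec n" "v \<noteq> 0\<^sub>v n" "K *\<^sub>v v = t \<cdot>\<^sub>v v"
    using mem_spectrum_iff[OF K] by blast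
  have "H_RKuLSIF n lam K *\<^sub>v v = m \<cdot>\<^sub>v v"
    unfolding H_RKuLSIF_mult_vec[OF K v(1)] v(3) m
    using v(1) by (intro eq_vecI) (auto simp: field_simps)
  then show "m \<in> spectrum (H_RKuLSIF n lam K)"
    using v mem_spectrum_iff[OF H_RKuLSIF_carrier[OF K]] by blast
qed

lemma spectrum_H_KuLSIF:
  assumes K: "K \<in> carrier_mat n n" and n: "n \<ge> 1" and pd: "sym_pos_def K" and lam: "lam > 0"
  shows "spectrum (H_KuLSIF n lam K) = (\<lambda>t. t * (t / real n + lam)) ` spectrum K"
proof (intro equalityI subsetI)
  fix m assume "m \<in> spectrum (H_KuLSIF n lam K)"
  then obtain v where v: "v \<in> carrier_vec n" "v \<noteq> 0\<^sub>v n"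
    and eig: "(1 / real n) \<cdot>\<^sub>v (K *\<^sub>v (K *\<^sub>v v)) + lam \<cdot>\<^sub>v (K *\<^sub>v v) = m \<cdot>\<^sub>v v"
    using mem_spectrum_iff[OF H_KuLSIF_carrier[OF K]] H_KuLSIF_mult_vec[OF K] by metis
  define a where "a = K *\<^sub>v v"
  have a: "a \<in> carrier_vec n" using K v by (simp add: a_def)
  have sym: "K\<^sup>T = K" and va: "v \<bullet> a > 0"
    using pd v K unfolding sym_pos_def_def a_def by auto
  have vv: "v \<bullet> v > 0" using scalar_prod_self_pos[OF v] .
  \<comment> \<open>Pairing the eigenvalue equation with \<open>v\<close> gives
    \<open>m |v|^2 = |K v|^2 / n + lam (v \<bullet> K v)\<close>, whence
    \<open>m > 0\<close>.\<close>
  have "m * (v \<bullet> v) = v \<bullet> ((1 / real n) \<cdot>\<^sub>v (K *\<^sub>v a) + lam \<cdot>\<^sub>v a)"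
    using eig v by (simp add: a_def)
  also have "\<dots> = (1 / real n) * (v \<bullet> (K *\<^sub>v a)) + lam * (v \<bullet> a)"
    using v a K by (subst scalar_prod_add_distrib[of _ n]) auto
  also have "v \<bullet> (K *\<^sub>v a) = a \<bullet> a"
    using symmetric_scalar_prod[OF K sym v(1) a] by (simp add: a_def)
  finally have "m * (v \<bullet> v) > 0"
    using va lam scalar_prod_self_nonneg[of a] by (simp add: add_nonneg_pos)
  then have m: "m > 0" using vv by (simp add: zero_less_mult_iff)
  \<comment> \<open>Quadratic formula for \<open>t^2 + n lam t - n m = 0\<close>: \<open>d\<close>
    is the root of the discriminant divided by \<open>n\<close>, and \<open>t\<close> is the
    positive solution.\<close>
  define d where "d = sqrt (lam\<^sup>2 + 4 * m / real n)"
  define t where "t = real n * (d - lam) / 2"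
  have d2: "d\<^sup>2 = lam\<^sup>2 + 4 * m / real n" using m by (simp add: d_def)
  have "d > lam" unfolding d_def using m n lam by (intro real_less_rsqrt) simp
  then have t0: "t > 0" using n by (simp add: t_def)
  have t: "t * (t + real n * lam) = real n * m"
  proof -
    have "t * (t + real n * lam) = (real n)\<^sup>2 * (d\<^sup>2 - lam\<^sup>2) / 4"
      by (simp add: t_def power2_eq_square field_simps)
    also have "d\<^sup>2 - lam\<^sup>2 = 4 * m / real n" by (simp add: d2)
    also have "(real n)\<^sup>2 * (4 * m / real n) / 4 = real n * m"
      using n by (simp add: power2_eq_square)
    finally show ?thesis .
  qed
  \<comment> \<open>The other root is \<open>s = - (t + n lam)\<close>, so
    \<open>w = (K - s I) v\<close>. It is nonzero because \<open>v \<bullet> w\<close> is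
    positive.\<close>
  define w where "w = a + (t + real n * lam) \<cdot>\<^sub>v v"
  have w: "w \<in> carrier_vec n" using a v by (simp add: w_def)
  have "v \<bullet> w = v \<bullet> a + (t + real n * lam) * (v \<bullet> v)"
    using a v by (simp add: w_def scalar_prod_add_distrib[of _ n])
  then have "v \<bullet> w > 0" using va vv t0 lam by (simp add: add_pos_nonneg)
  then have "w \<noteq> 0\<^sub>v n" using v by auto
  \<comment> \<open>\<open>(K - t I) (K - s I) = K^2 + n lam K - n m I\<close> is \<open>n\<close>
    times the Hessian minus \<open>m I\<close>, which annihilates \<open>v\<close>.\<close>
  moreover have "K *\<^sub>v w = t \<cdot>\<^sub>v w"
  proof (rule eq_vecI)
    fix i assume "i < dim_vec (t \<cdot>\<^sub>v w)"
    then have i: "i < n" using w by simp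
    have "(1 / real n) * (K *\<^sub>v a) $ i + lam * a $ i = m * v $ i"
      using arg_cong[OF eig, of "\<lambda>u. u $ i"] i v a K
      by (simp add: a_def[symmetric] del: index_mult_mat_vec)
    then have "(K *\<^sub>v a) $ i + real n * lam * a $ i = (real n * m) * v $ i"
      using n by (simp add: field_simps del: index_mult_mat_vec)
    then have "(K *\<^sub>v a) $ i + real n * lam * a $ i = t * (t + real n * lam) * v $ i"
      by (simp only: t)
    moreover have "K *\<^sub>v w = K *\<^sub>v a + (t + real n * lam) \<cdot>\<^sub>v a"
      using K a v by (simp add: w_def a_def mult_add_distrib_mat_vec[of _ n n] mult_mat_vec[of _ n n])
    ultimately show "(K *\<^sub>v w) $ i = (t \<cdot>\<^sub>v w) $ i"
      using i a v w K by (simp add: w_def algebra_simps del: index_mult_mat_vec)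
  qed (use w K in auto)
  ultimately have "t \<in> spectrum K" using w mem_spectrum_iff[OF K] by blast
  moreover have "m = t * (t / real n + lam)" using t n by (simp add: field_simps)
  ultimately show "m \<in> (\<lambda>t. t * (t / real n + lam)) ` spectrum K" by blast
next
  fix m assume "m \<in> (\<lambda>t. t * (t / real n + lam)) ` spectrum K"
  then obtain t v where m: "m = t * (t / real n + lam)"
    and v: "v \<in> carrier_vec n" "v \<noteq> 0\<^sub>v n" "K *\<^sub>v v = t \<cdot>\<^sub>v v"
    using mem_spectrum_iff[OF K] by blast
  have "H_KuLSIF n lam K *\<^sub>v v = m \<cdot>\<^sub>v v"
    unfolding H_KuLSIF_mult_vec[OF K v(1)] v(3) mult_mat_vec[OF K v(1)] m
    using v(1) by (intro eq_vecI) (auto simp: field_simps)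
  then show "m \<in> spectrum (H_KuLSIF n lam K)"
    using v mem_spectrum_iff[OF H_KuLSIF_carrier[OF K]] by blast
qed

section \<open>Extreme eigenvalues and condition numbers\<close>

lemma
  assumes "finite S" "S \<noteq> {}" "mono_on S f"
  shows Max_image_mono_on: "Max (f ` S) = f (Max S)"
    and Min_image_mono_on: "Min (f ` S) = f (Min S)"
  using assms by (auto intro!: Max_eqI Min_eqI imageI Max_in Min_in elim!: mono_onD)

theorem mainTheorem4:
  fixes k :: "'a \<Rightarrow> 'a \<Rightarrow> real" and X :: "nat \<Rightarrow> 'a" and n :: nat and lam :: real
    and K11 :: "real mat"
  assumes "n \<ge> 1"
    and "pd_kernel k"
    and "K11 = gram_mat k n X"
    and "sym_pos_def K11"
    and "lam > 0"
  shows "cond_num (H_KuLSIF n lam K11) = cond_num K11 * cond_num (H_RKuLSIF n lam K11) \<and>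
         cond_num (H_RKuLSIF n lam K11) \<le> cond_num (H_KuLSIF n lam K11) \<and>
         cond_num (H_RKuLSIF n lam K11) \<le> cond_num K11"
proof -
  have K: "K11 \<in> carrier_mat n n" using assms(3) by (simp add: gram_mat_def)
  let ?S = "spectrum K11"
  let ?q = "\<lambda>t. t / real n + lam"
  have fin: "finite ?S" using card_finite_spectrum(1)[OF K] .
  have ne: "?S \<noteq> {}"
    using spectrum_symmetric_nonempty[OF K] assms(1,4) by (simp add: sym_pos_def_def)
  have pos: "t > 0" if "t \<in> ?S" for t using sym_pos_def_spectrum_pos[OF K assms(4) that] .
  define a b where "a = Min ?S" and "b = Max ?S"
  have a0: "a > 0" using pos Min_in[OF fin ne] by (simp add: a_def)
  have ab: "a \<le> b" unfolding a_def b_def using fin ne by simp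
  have qa: "?q a > 0" and qab: "?q a \<le> ?q b"
    using a0 ab assms(1,5) by (auto intro: add_pos_pos divide_right_mono)
  have mono_q: "mono_on ?S ?q"
    by (auto intro!: mono_onI divide_right_mono)
  \<comment> \<open>On the positive spectrum this is a product of two nonnegative increasing
    factors.\<close>
  have mono_p: "mono_on ?S (\<lambda>t. t * ?q t)"
    using pos assms(5)
    by (intro mono_onI mult_mono) (auto intro!: divide_right_mono add_nonneg_nonneg simp: less_imp_le)
  have cK: "cond_num K11 = b / a" by (simp add: cond_num_def a_def b_def)
  have cR: "cond_num (H_RKuLSIF n lam K11) = ?q b / ?q a"
    unfolding cond_num_def spectrum_H_RKuLSIF[OF K assms(1)]
    by (simp add: Max_image_mono_on[OF fin ne mono_q] Min_image_mono_on[OF fin ne mono_q] a_def b_def)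
  have cH: "cond_num (H_KuLSIF n lam K11) = (b * ?q b) / (a * ?q a)"
    unfolding cond_num_def spectrum_H_KuLSIF[OF K assms(1,4,5)]
    by (simp add: Max_image_mono_on[OF fin ne mono_p] Min_image_mono_on[OF fin ne mono_p] a_def b_def)
  \<comment> \<open>The quotient of the values of \<open>t * ?q t\<close> at \<open>b\<close> and
    \<open>a\<close> splits into \<open>b / a\<close> and \<open>?q b / ?q a\<close>.\<close>
  have eq: "cond_num (H_KuLSIF n lam K11) = cond_num K11 * cond_num (H_RKuLSIF n lam K11)"
    unfolding cK cR cH by simp
  moreover have "cond_num (H_RKuLSIF n lam K11) \<le> cond_num (H_KuLSIF n lam K11)"
  proof -
    \<comment> \<open>The factor \<open>b / a\<close> is the condition number of \<open>K11\<close>,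
      at least 1 since \<open>0 < a \<le> b\<close>.\<close>
    have "1 \<le> b / a" "0 \<le> ?q b / ?q a" using a0 ab qa qab by auto
    then show ?thesis unfolding eq cK cR using mult_right_mono[of 1 "b / a" "?q b / ?q a"] by simp
  qed
  moreover have "cond_num (H_RKuLSIF n lam K11) \<le> cond_num K11"
  proof -
    \<comment> \<open>Cross-multiplying \<open>?q b / ?q a \<le> b / a\<close> leaves exactly this
      inequality, as \<open>a b / n\<close> occurs on both sides.\<close>
    have "lam * a \<le> lam * b" using ab assms(5) by simp
    then have "?q b * a \<le> b * ?q a" by (simp add: algebra_simps)
    then show ?thesis unfolding cK cR
      using a0 qa by (simp add: pos_divide_le_eq pos_le_divide_eq)
  qed
  ultimately show ?thesis by blast
qed

end
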